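(* Let $X$, $Y$ be (real or complex) Banach spaces, $\Omega\subseteq X$ an open set and $F:\Omega\to Y$ a continuously differentiable function. Let $x_*\in\Omega$, $R>0$ and $\kappa:=\sup\{t\in[0,R): B(x_*,t)\subset\Omega\}$. Suppose that $F(x_* )=0$, that $F'(x_* )$ is invertible, and that there exists a continuously differentiable function $f:[0,R)\to\mathbb{R}$ such that $$\left\|F'(x_* )^{-1}\left[F'(x)-F'(x_*+\tau(x-x_* ))\right]\right\|\leq f'(\|x-x_*\|)-f'(\tau\|x-x_*\|)$$ for all $\tau\in[0,1]$ and $x\in B(x_*,\kappa)$, and such that (h1) $f(0)=0$ and $f'(0)=-1$; (h2) $f'$ is strictly increasing. Let $$\nu:=\sup\{t\in[0,R): f'(t)<0\},\qquad \rho:=\sup\{\delta\in(0,\nu): [f(t)/f'(t)-t]/t<1 \text{ for all } t\in(0,\delta)\},$$ $$r:=\min\{\kappa,\rho\},\qquad \sigma:=\sup\{t\in(0,\kappa): f(t)<0\}.$$ Then for every starting point $x_0\in B(x_*,r)\setminus\{x_*\}$ and $t_0=\|x_0-x_*\|$, the sequences $$x_{k+1}=x_k-F'(x_k)^{-1}F(x_k),\qquad t_{k+1}=|t_k-f(t_k)/f'(t_k)|,\qquad k=0,1,\ldots,$$ are well defined; $\{t_k\}$ is strictly decreasing, is contained in $(0,r)$ and converges to $0$; $\{x_k\}$ is contained in $B(x_*,r)$ and converges to $x_*$, which is the unique zero of $F$ in $B(x_*,\sigma)$; and $$\lim_{k\to\infty}\frac{\|x_{k+1}-x_*\|}{\|x_k-x_*\|}=0,\qquad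 \lim_{k\to\infty}\frac{t_{k+1}}{t_k}=0.$$ Moreover, if $f(\rho)/(\rho f'(\rho))-1=1$ and $\rho<\kappa$, then $r=\rho$ is the best possible convergence radius. If, additionally, for a given $0\leq p\leq 1$, (h3) the function $(0,\nu)\ni t\mapsto [f(t)/f'(t)-t]/t^{p+1}$ is strictly increasing, then the sequence $\{t_{k+1}/t_k^{p+1}\}$ is strictly decreasing and $$\|x_{k+1}-x_*\|\leq\big[t_{k+1}/t_k^{p+1}\big]\,\|x_k-x_*\|^{p+1},\qquad k=0,1,\ldots.$$
   Context: $B(x,\delta)=\{y\in X:\|x-y\|<\delta\}$ is the open ball. $F'(x):X\to Y$ denotes the Fréchet derivative of $F$ at $x$ (a bounded linear map). "Well defined" means that at each step $x_k\in\Omega$ with $F'(x_k)$ invertible, and $t_k\in[0,R)$ with $f'(t_k)\neq0$. In the limit of $\|x_{k+1}-x_*\|/\|x_k-x_*\|$, the quotient is read as $0$ if $x_k=x_*$. "$r=\rho$ is the best possible convergence radius" means that, for the given $R$, $f$ and $\kappa$, no number $r'>\rho$ can replace $\rho$: for every $r'>\rho$ there exist Banach spaces, an open set, a map and a zero $(X,Y,\Omega,F,x_* )$ satisfying all the hypotheses (including (h1), (h2)) with these same $R$, $f$, $\kappa$, and a starting point $x_0\in\Omega$ with $0<\|x_0-x_*\|<r'$, such that Newton's method started at $x_0$ fails to produce a well defined sequence converging to $x_*$. *)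

theory Defs
  imports "HOL-Analysis.Analysis"
begin

(* Banach spaces are rendered by the class banach, i.e. over the reals. A complex Banach
   space is a real one by restriction of scalars; a complex Frechet derivative is then also
   the real one, and norms and inverses of complex-linear maps do not change. Hence
   universally quantified results over this class include the complex case. *)

definition blinfun_invertible ::
    "('a::real_normed_vector \<Rightarrow>\<^sub>L 'b::real_normed_vector) \<Rightarrow> bool" where
  "blinfun_invertible A \<longleftrightarrow> (\<exists>B. B o\<^sub>L A = id_blinfun \<and> A o\<^sub>L B = id_blinfun)"

(* Unspecified when A is not invertible. *)
definition blinfun_inverse ::
    "('a::real_normed_vector \<Rightarrow>\<^sub>L 'b::real_normed_vector) \<Rightarrow> ('b \<Rightarrow>\<^sub>L 'a)" where
  "blinfun_inverse A = (THE B. B o\<^sub>L A = id_blinfun \<and> A o\<^sub>L B = id_blinfun)"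

definition domain_radius :: "real \<Rightarrow> 'a::banach set \<Rightarrow> 'a \<Rightarrow> real" where
  "domain_radius R \<Omega> xs = Sup {t \<in> {0..<R}. ball xs t \<subseteq> \<Omega>}"

(* F is only relevant on \<Omega> and f only on [0,R). DF and f' are the derivatives, which these
   conditions determine uniquely there (one-sided for f at 0). *)
definition majorant_setting ::
    "'a::banach set \<Rightarrow> ('a \<Rightarrow> 'b::banach) \<Rightarrow> ('a \<Rightarrow> 'a \<Rightarrow>\<^sub>L 'b) \<Rightarrow> 'a \<Rightarrow>
     real \<Rightarrow> (real \<Rightarrow> real) \<Rightarrow> (real \<Rightarrow> real) \<Rightarrow> bool" where
  "majorant_setting \<Omega> F DF xs R f f' \<longleftrightarrow>
     open \<Omega> \<and> xs \<in> \<Omega> \<and> 0 < R \<and>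
     (\<forall>x\<in>\<Omega>. (F has_derivative blinfun_apply (DF x)) (at x)) \<and> continuous_on \<Omega> DF \<and>
     F xs = 0 \<and> blinfun_invertible (DF xs) \<and>
     (\<forall>t\<in>{0..<R}. (f has_real_derivative f' t) (at t within {0..<R})) \<and>
     continuous_on {0..<R} f' \<and>
     (\<forall>\<tau>\<in>{0..1}. \<forall>x\<in>ball xs (domain_radius R \<Omega> xs).
        norm (blinfun_inverse (DF xs) o\<^sub>L (DF x - DF (xs + \<tau> *\<^sub>R (x - xs))))
          \<le> f' (norm (x - xs)) - f' (\<tau> * norm (x - xs))) \<and>
     f 0 = 0 \<and> f' 0 = - 1 \<and>
     strict_mono_on {0..<R} f'"

primrec newton_seq ::
    "('a::banach \<Rightarrow> 'b::banach) \<Rightarrow> ('a \<Rightarrow> 'a \<Rightarrow>\<^sub>L 'b) \<Rightarrow> 'a \<Rightarrow> nat \<Rightarrow> 'a" where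
  "newton_seq F DF x0 0 = x0"
| "newton_seq F DF x0 (Suc k) =
     newton_seq F DF x0 k
       - blinfun_inverse (DF (newton_seq F DF x0 k)) (F (newton_seq F DF x0 k))"

definition newton_well_defined ::
    "'a::banach set \<Rightarrow> ('a \<Rightarrow> 'b::banach) \<Rightarrow> ('a \<Rightarrow> 'a \<Rightarrow>\<^sub>L 'b) \<Rightarrow> 'a \<Rightarrow> bool" where
  "newton_well_defined \<Omega> F DF x0 \<longleftrightarrow>
     (\<forall>k. newton_seq F DF x0 k \<in> \<Omega> \<and> blinfun_invertible (DF (newton_seq F DF x0 k)))"

primrec scalar_newton_seq ::
    "(real \<Rightarrow> real) \<Rightarrow> (real \<Rightarrow> real) \<Rightarrow> real \<Rightarrow> nat \<Rightarrow> real" where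
  "scalar_newton_seq f f' t0 0 = t0"
| "scalar_newton_seq f f' t0 (Suc k) =
     \<bar>scalar_newton_seq f f' t0 k
        - f (scalar_newton_seq f f' t0 k) / f' (scalar_newton_seq f f' t0 k)\<bar>"

definition scalar_newton_well_defined ::
    "real \<Rightarrow> (real \<Rightarrow> real) \<Rightarrow> (real \<Rightarrow> real) \<Rightarrow> real \<Rightarrow> bool" where
  "scalar_newton_well_defined R f f' t0 \<longleftrightarrow>
     (\<forall>k. scalar_newton_seq f f' t0 k \<in> {0..<R} \<and> f' (scalar_newton_seq f f' t0 k) \<noteq> 0)"

(* No radius beyond \<rho> works for all problems sharing R, f and \<kappa>. HOL cannot quantify
   existentially over types, so the failing problem is required on X = Y = real, which is
   stronger than asking for it on some pair of Banach spaces. *)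
definition best_convergence_radius ::
    "real \<Rightarrow> (real \<Rightarrow> real) \<Rightarrow> (real \<Rightarrow> real) \<Rightarrow> real \<Rightarrow> real \<Rightarrow> bool" where
  "best_convergence_radius R f f' \<kappa> \<rho> \<longleftrightarrow>
     (\<forall>r'>\<rho>. \<exists>(\<Omega> :: real set) (F :: real \<Rightarrow> real) DF xs x0.
        majorant_setting \<Omega> F DF xs R f f' \<and> domain_radius R \<Omega> xs = \<kappa> \<and>
        x0 \<in> \<Omega> \<and> 0 < norm (x0 - xs) \<and> norm (x0 - xs) < r' \<and>
        \<not> (newton_well_defined \<Omega> F DF x0 \<and> newton_seq F DF x0 \<longlonglongrightarrow> xs))"

end

theory Submission
  imports Defs
begin

text \<open>
  Everything is controlled by two Taylor remainders. Write \<open>t = \<parallel>x - x\<^sub>*\<parallel>\<close>. Integrating the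
  majorant condition along the segment from \<open>x\<^sub>*\<close> to \<open>x\<close> compares the remainder of \<open>F\<close>
  expanded at \<open>x\<close> with that of \<open>f\<close> expanded at \<open>t\<close>, namely \<open>t f'(t) - f(t)\<close>
  (\<open>newton_error\<close>), and the remainder of \<open>F\<close> expanded at \<open>x\<^sub>*\<close> with that of \<open>f\<close> expanded
  at \<open>0\<close>, namely \<open>f(t) + t\<close> (\<open>center_error\<close>).

  Taking \<open>\<tau> = 0\<close> in the majorant condition shows that \<open>F'(x\<^sub>*)\<^sup>-\<^sup>1 F'(x)\<close> differs from the
  identity by at most \<open>f'(t) + 1\<close>, which is below \<open>1\<close> exactly as long as \<open>f'(t) < 0\<close>. So
  \<open>F'(x)\<close> is invertible and its inverse, relative to \<open>F'(x\<^sub>*)\<close>, has norm at most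
  \<open>1 / (- f'(t))\<close> (\<open>derivative_invertible\<close>). Multiplying this by the first remainder, one Newton
  step from \<open>x\<close> lands within \<open>gap t = f(t)/f'(t) - t\<close> of \<open>x\<^sub>*\<close> (\<open>newton_contraction\<close>). That
  number is also the modulus of the scalar Newton step at \<open>t\<close>.

  Strict monotonicity of \<open>f'\<close> makes \<open>gap\<close> positive and strictly increasing on \<open>(0, \<nu>)\<close>, and
  \<open>gap t / t\<close> tends to \<open>0\<close> with \<open>t\<close>. Below \<open>\<rho>\<close> one has \<open>gap t < t\<close>, so the scalar sequence
  decreases, and its limit must be \<open>0\<close> since \<open>gap\<close> is continuous and has no fixed point in
  \<open>(0, \<rho>)\<close>. By monotonicity of \<open>gap\<close> the errors of the Newton sequence stay below the scalar
  sequence. All statements on limits and on the order \<open>p + 1\<close> are then statements about \<open>gap\<close>.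

  A zero \<open>x \<noteq> x\<^sub>*\<close> would turn the second remainder estimate into \<open>t \<le> f(t) + t\<close>, impossible
  where \<open>f(t) < 0\<close>; convexity of \<open>f\<close> makes this the case for all \<open>t\<close> in \<open>(0, \<sigma>)\<close>. For
  sharpness, the odd extension of \<open>f\<close> is itself a problem with majorant \<open>f\<close>, and the
  condition at \<open>\<rho>\<close> says that Newton's method for it alternates between \<open>\<rho>\<close> and \<open>- \<rho>\<close>.
\<close>

section \<open>Inverses of bounded linear maps\<close>

lemma blinfun_inverse_eqI:
  assumes "B o\<^sub>L A = id_blinfun" and "A o\<^sub>L B = id_blinfun"
  shows "blinfun_inverse A = B"
  unfolding blinfun_inverse_def
proof (rule the_equality)
  show "B o\<^sub>L A = id_blinfun \<and> A o\<^sub>L B = id_blinfun" using assms by simp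
  fix C assume C: "C o\<^sub>L A = id_blinfun \<and> A o\<^sub>L C = id_blinfun"
  show "C = B"
  proof (rule blinfun_eqI)
    fix y
    have "A (B y) = y" using assms(2) by (metis blinfun_apply_blinfun_compose blinfun_apply_id_blinfun)
    moreover have "C (A (B y)) = B y"
      using C by (metis blinfun_apply_blinfun_compose blinfun_apply_id_blinfun)
    ultimately show "C y = B y" by simp
  qed
qed

lemma blinfun_inverse:
  assumes "blinfun_invertible A"
  shows "blinfun_inverse A (A x) = x" and "A (blinfun_inverse A y) = y"
proof -
  obtain B where B: "B o\<^sub>L A = id_blinfun" "A o\<^sub>L B = id_blinfun"
    using assms unfolding blinfun_invertible_def by blast
  have "blinfun_inverse A = B" using B by (rule blinfun_inverse_eqI)
  then show "blinfun_inverse A (A x) = x" and "A (blinfun_inverse A y) = y"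
    using B by (metis blinfun_apply_blinfun_compose blinfun_apply_id_blinfun)+
qed

lemma blinfun_invertibleI:
  assumes A: "bounded_linear B" and "\<And>x. B (blinfun_apply A x) = x" and "\<And>y. blinfun_apply A (B y) = y"
  shows "blinfun_invertible A"
  unfolding blinfun_invertible_def
proof (intro exI conjI)
  show "Blinfun B o\<^sub>L A = id_blinfun"
    using assms by (intro blinfun_eqI) (simp add: bounded_linear_Blinfun_apply)
  show "A o\<^sub>L Blinfun B = id_blinfun"
    using assms by (intro blinfun_eqI) (simp add: bounded_linear_Blinfun_apply)
qed

text \<open>
  The Banach perturbation lemma. Solving \<open>T x = y\<close> amounts to finding a fixed point of
  \<open>x \<mapsto> A\<^sup>-\<^sup>1 y - A\<^sup>-\<^sup>1 (T - A) x\<close>, a contraction with factor \<open>q\<close>; this replaces the Neumann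
  series. The lower bound on \<open>A\<^sup>-\<^sup>1 T\<close> expresses that \<open>T\<^sup>-\<^sup>1 A\<close> has norm at most \<open>1 / (1 - q)\<close>.
\<close>

lemma invertible_near_invertible:
  fixes A T :: "'a::banach \<Rightarrow>\<^sub>L 'b::real_normed_vector"
  assumes A: "blinfun_invertible A"
    and q: "norm (blinfun_inverse A o\<^sub>L (T - A)) \<le> q" "q < 1"
  shows "blinfun_invertible T"
    and "(1 - q) * norm x \<le> norm (blinfun_inverse A (T x))"
proof -
  let ?J = "blinfun_inverse A"
  define E where "E = ?J o\<^sub>L (T - A)"
  have J: "?J (T x) = x + E x" for x
    by (simp add: E_def blinfun.bilinear_simps blinfun_inverse[OF A])
  have E: "norm (E x) \<le> q * norm x" for x
    using norm_blinfun[of E x] q(1) mult_right_mono[OF q(1) norm_ge_zero, of x]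
    by (simp add: E_def)
  have q0: "0 \<le> q" using q(1) norm_ge_zero order_trans by blast
  have lower: "(1 - q) * norm x \<le> norm (?J (T x))" for x
  proof -
    have "norm x - norm (E x) \<le> norm (x + E x)" by (metis norm_diff_ineq)
    then show ?thesis using E[of x] J[of x] by (simp add: algebra_simps)
  qed
  then show "(1 - q) * norm x \<le> norm (?J (T x))" .
  have surj: "\<exists>x. T x = y" for y
  proof -
    have "\<exists>!x. ?J y - E x = x"
    proof (rule banach_fix_type[OF q0 q(2)], intro allI)
      fix u v
      have "dist (?J y - E u) (?J y - E v) = norm (E (u - v))"
        by (simp add: dist_norm blinfun.bilinear_simps norm_minus_commute)
      then show "dist (?J y - E u) (?J y - E v) \<le> q * dist u v"
        using E[of "u - v"] by (simp add: dist_norm)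
    qed
    then obtain x where "?J y - E x = x" by blast
    then have "?J (T x) = ?J y" using J[of x] by (simp add: algebra_simps)
    then have "T x = y" by (metis blinfun_inverse(2)[OF A])
    then show ?thesis ..
  qed
  have inj: "u = v" if "T u = T v" for u v
  proof -
    have "(1 - q) * norm (u - v) \<le> 0"
      using lower[of "u - v"] that by (simp add: blinfun.bilinear_simps)
    then show ?thesis using q(2) by (simp add: mult_le_0_iff)
  qed
  define S where "S = (\<lambda>y. SOME x. T x = y)"
  have TS: "T (S y) = y" for y unfolding S_def using surj by (rule someI_ex)
  have "bounded_linear S"
  proof (rule bounded_linear_intro)
    show "S (u + v) = S u + S v" for u v by (rule inj) (simp add: TS blinfun.bilinear_simps)
    show "S (c *\<^sub>R u) = c *\<^sub>R S u" for c u by (rule inj) (simp add: TS blinfun.bilinear_simps)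
    show "norm (S y) \<le> norm y * (norm ?J / (1 - q))" for y
    proof -
      have "(1 - q) * norm (S y) \<le> norm ?J * norm y"
        using lower[of "S y"] norm_blinfun[of ?J y] by (simp add: TS)
      then show ?thesis using q(2) by (simp add: field_simps)
    qed
  qed
  then show "blinfun_invertible T"
    by (rule blinfun_invertibleI) (auto intro: inj simp: TS)
qed

section \<open>Scalar majorants\<close>

locale scalar_majorant =
  fixes R :: real and f f' :: "real \<Rightarrow> real"
  assumes R_pos: "0 < R"
    and deriv: "\<And>t. t \<in> {0..<R} \<Longrightarrow> (f has_real_derivative f' t) (at t within {0..<R})"
    and deriv_cont: "continuous_on {0..<R} f'"
    and f_zero: "f 0 = 0" and deriv_zero: "f' 0 = - 1"
    and deriv_mono: "strict_mono_on {0..<R} f'"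
begin

definition nu :: real where "nu = Sup {t \<in> {0..<R}. f' t < 0}"

text \<open>
  The Newton step at \<open>t\<close> leads to \<open>- gap t\<close>: it overshoots the zero of \<open>f\<close> at the origin by this
  amount.
\<close>

definition gap :: "real \<Rightarrow> real" where "gap t = f t / f' t - t"

definition rho :: real where
  "rho = Sup {\<delta> \<in> {0<..<nu}. \<forall>t\<in>{0<..<\<delta>}. (f t / f' t - t) / t < 1}"

lemma deriv_less: "0 \<le> s \<Longrightarrow> s < t \<Longrightarrow> t < R \<Longrightarrow> f' s < f' t"
  using deriv_mono by (auto simp: strict_mono_on_def)

lemma deriv_le: "0 \<le> s \<Longrightarrow> s \<le> t \<Longrightarrow> t < R \<Longrightarrow> f' s \<le> f' t"
  using deriv_less[of s t] by (cases "s = t") auto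

lemma f_cont: "continuous_on {0..<R} f"
  using DERIV_continuous[OF deriv] by (simp add: continuous_on_eq_continuous_within)

lemma deriv_interior: "0 < t \<Longrightarrow> t < R \<Longrightarrow> (f has_real_derivative f' t) (at t)"
  using deriv[of t] at_within_interior[of t "{0..<R}"] by (simp add: interior_atLeastLessThan)

lemma mean_value:
  assumes "0 \<le> s" "s < t" "t < R"
  obtains \<xi> where "s < \<xi>" "\<xi> < t" "f t - f s = f' \<xi> * (t - s)"
proof -
  have "\<exists>\<xi>\<in>{s<..<t}. f t - f s = (\<lambda>h. f' \<xi> * h) (t - s)"
  proof (rule mvt_simple)
    fix u assume "s \<le> u" "u \<le> t"
    then have "(f has_real_derivative f' u) (at u within {s..t})"
      using assms by (intro DERIV_subset[OF deriv]) auto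
    then show "(f has_derivative (\<lambda>h. f' u * h)) (at u within {s..t})"
      by (simp add: has_field_derivative_def)
  qed (use assms in auto)
  then show thesis using that by auto
qed

text \<open>
  The quantity \<open>t f'(t) - f(t)\<close> is the remainder at \<open>0\<close> of the expansion of \<open>f\<close> at \<open>t\<close>.
  Strict convexity of \<open>f\<close> makes it positive and increasing; it is the numerator of \<open>gap\<close>
  (see \<open>gap_eq\<close>).
\<close>

lemma excess_pos:
  assumes "0 < t" "t < R"
  shows "0 < t * f' t - f t"
proof -
  obtain \<xi> where x: "0 < \<xi>" "\<xi> < t" "f t - f 0 = f' \<xi> * (t - 0)"
    using mean_value[of 0 t] assms by auto
  have "f' \<xi> * t < f' t * t"
    using deriv_less[of \<xi> t] x assms by (intro mult_strict_right_mono) auto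
  then show ?thesis using x f_zero by (simp add: mult.commute)
qed

lemma excess_less:
  assumes "0 \<le> s" "s < t" "t < R"
  shows "s * f' s - f s < t * f' t - f t"
proof -
  obtain \<xi> where x: "s < \<xi>" "\<xi> < t" "f t - f s = f' \<xi> * (t - s)"
    using mean_value assms by metis
  have "f' \<xi> * (t - s) < f' t * (t - s)"
    using deriv_less[of \<xi> t] x assms by (intro mult_strict_right_mono) auto
  moreover have "s * f' s \<le> s * f' t"
    using deriv_less assms by (intro mult_left_mono) (auto intro: less_imp_le)
  ultimately show ?thesis using x by (simp add: algebra_simps)
qed

lemma at_zero_within: "at 0 within {0..<R} = at_right 0"
  by (rule at_within_nhd[of 0 "{..<R}"]) (use R_pos in auto)

lemma tendsto_at_right_zero:
  assumes "continuous_on {0..<R} g"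
  shows "(g \<longlongrightarrow> g 0) (at_right 0)"
proof -
  have "(g \<longlongrightarrow> g 0) (at 0 within {0..<R})"
    using assms R_pos by (simp add: continuous_on)
  then show ?thesis by (simp only: at_zero_within)
qed

lemma eventually_less_R: "\<forall>\<^sub>F t in at_right 0. 0 < t \<and> t < R"
  using R_pos eventually_at_right_field by blast

lemma secant_tendsto: "((\<lambda>t. f t / t) \<longlongrightarrow> - 1) (at_right 0)"
  using deriv[of 0] R_pos f_zero deriv_zero
  by (simp add: has_field_derivative_iff at_zero_within)

text \<open>
  Both \<open>f(t)/t\<close> and \<open>f'(t)\<close> tend to \<open>f'(0) = - 1\<close>, so their quotient tends to \<open>1\<close>. This is
  the source of superlinear convergence, and it also makes \<open>\<rho>\<close> positive.
\<close>

lemma gap_ratio_tendsto: "((\<lambda>t. gap t / t) \<longlongrightarrow> 0) (at_right 0)"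
proof -
  note secant_tendsto
  moreover have "(f' \<longlongrightarrow> - 1) (at_right 0)"
    using tendsto_at_right_zero[OF deriv_cont] deriv_zero by simp
  ultimately have "((\<lambda>t. (f t / t) / f' t - 1) \<longlongrightarrow> (- 1) / (- 1) - 1) (at_right 0)"
    by (intro tendsto_intros) auto
  moreover have "\<forall>\<^sub>F t in at_right 0. (f t / t) / f' t - 1 = gap t / t"
    using eventually_less_R by eventually_elim (simp add: gap_def diff_divide_distrib)
  ultimately show ?thesis using tendsto_cong by fastforce
qed

lemma deriv_neg_set: "\<exists>t. 0 < t \<and> t < R \<and> f' t < 0"
proof -
  have "(f' \<longlongrightarrow> - 1) (at_right 0)"
    using tendsto_at_right_zero[OF deriv_cont] deriv_zero by simp
  then have "\<forall>\<^sub>F t in at_right 0. f' t < 0" by (rule order_tendstoD) simp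
  with eventually_less_R have "\<forall>\<^sub>F t in at_right 0. 0 < t \<and> t < R \<and> f' t < 0"
    by eventually_elim auto
  then show ?thesis using eventually_happens trivial_limit_at_right_real by blast
qed

lemma nu_bdd: "bdd_above {t \<in> {0..<R}. f' t < 0}"
  by (rule bdd_aboveI[of _ R]) auto

lemma nu_pos: "0 < nu"
proof -
  obtain t where "0 < t" "t < R" "f' t < 0" using deriv_neg_set by blast
  then show ?thesis unfolding nu_def using less_cSup_iff[OF _ nu_bdd] by force
qed

lemma nu_le: "nu \<le> R"
  unfolding nu_def using R_pos deriv_zero by (intro cSup_least) auto

lemma deriv_neg:
  assumes "0 \<le> t" "t < nu"
  shows "f' t < 0"
proof -
  have "{t \<in> {0..<R}. f' t < 0} \<noteq> {}" using R_pos deriv_zero by auto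
  then obtain u where "u \<in> {0..<R}" "f' u < 0" "t < u"
    using assms less_cSup_iff[OF _ nu_bdd] unfolding nu_def by blast
  then show ?thesis using deriv_less[of t u] assms by auto
qed

lemma gap_eq:
  assumes "0 \<le> t" "t < nu"
  shows "gap t = (t * f' t - f t) / (- f' t)"
  using deriv_neg[OF assms] by (simp add: gap_def field_simps)

lemma gap_pos: "0 < t \<Longrightarrow> t < nu \<Longrightarrow> 0 < gap t"
  using gap_eq[of t] excess_pos[of t] deriv_neg[of t] nu_le by (simp add: divide_pos_pos divide_pos_neg)

lemma gap_zero: "gap 0 = 0"
  by (simp add: gap_def f_zero)

text \<open>Going to the right, the numerator in \<open>gap_eq\<close> grows and the positive denominator shrinks.\<close>

lemma gap_less:
  assumes "0 \<le> s" "s < t" "t < nu"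
  shows "gap s < gap t"
proof -
  have "(s * f' s - f s) / (- f' s) \<le> (s * f' s - f s) / (- f' t)"
  proof (rule divide_left_mono)
    show "0 \<le> s * f' s - f s"
      using excess_pos[of s] assms nu_le f_zero by (cases "s = 0") auto
    show "- f' t \<le> - f' s" using deriv_less[of s t] assms nu_le by auto
    show "0 < - f' s * - f' t" using deriv_neg[of s] deriv_neg[of t] assms
      by (simp add: mult_neg_neg)
  qed
  also have "\<dots> < (t * f' t - f t) / (- f' t)"
    using excess_less[of s t] assms nu_le deriv_neg[of t] by (intro divide_strict_right_mono) auto
  finally show ?thesis using assms by (simp add: gap_eq)
qed

lemma gap_le: "0 \<le> s \<Longrightarrow> s \<le> t \<Longrightarrow> t < nu \<Longrightarrow> gap s \<le> gap t"
  using gap_less[of s t] by (cases "s = t") auto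

lemma rho_bdd: "bdd_above {\<delta> \<in> {0<..<nu}. \<forall>t\<in>{0<..<\<delta>}. (f t / f' t - t) / t < 1}"
  by (rule bdd_aboveI[of _ nu]) auto

lemma rho_set: "\<exists>\<delta>\<in>{0<..<nu}. \<forall>t\<in>{0<..<\<delta>}. (f t / f' t - t) / t < 1"
proof -
  have "\<forall>\<^sub>F t in at_right 0. gap t / t < 1"
    using order_tendstoD(2)[OF gap_ratio_tendsto] by simp
  then obtain b where b: "0 < b" "\<And>t. 0 < t \<Longrightarrow> t < b \<Longrightarrow> gap t / t < 1"
    by (auto simp: eventually_at_right_field)
  show ?thesis
    using b nu_pos by (intro bexI[of _ "min b (nu / 2)"]) (auto simp: gap_def)
qed

lemma rho_pos: "0 < rho"
proof -
  obtain \<delta> where "\<delta> \<in> {\<delta> \<in> {0<..<nu}. \<forall>t\<in>{0<..<\<delta>}. (f t / f' t - t) / t < 1}"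
    using rho_set by blast
  moreover from this have "\<delta> \<le> rho" unfolding rho_def using rho_bdd by (intro cSup_upper)
  ultimately show ?thesis by auto
qed

lemma rho_le: "rho \<le> nu"
  unfolding rho_def using rho_set by (intro cSup_least) auto

lemma gap_less_self:
  assumes "0 < t" "t < rho"
  shows "gap t < t"
proof -
  have "{\<delta> \<in> {0<..<nu}. \<forall>t\<in>{0<..<\<delta>}. (f t / f' t - t) / t < 1} \<noteq> {}"
    using rho_set by blast
  then obtain \<delta> where "\<forall>u\<in>{0<..<\<delta>}. (f u / f' u - u) / u < 1" "t < \<delta>"
    using assms(2) less_cSup_iff[OF _ rho_bdd] unfolding rho_def by blast
  then have "gap t / t < 1" using assms by (simp add: gap_def)
  then show ?thesis using assms by simp
qed

text \<open>
  A convex function vanishing at \<open>0\<close> cannot return below zero once it has become nonnegative: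
  otherwise the slope of one of its chords would exceed that of a later one.
\<close>

lemma neg_before_neg:
  assumes "0 < s" "s < t" "t < R" "f t < 0"
  shows "f s < 0"
proof (rule ccontr)
  assume "\<not> f s < 0"
  obtain \<xi> where x: "0 < \<xi>" "\<xi> < s" "f s - f 0 = f' \<xi> * (s - 0)"
    using mean_value[of 0 s] assms by auto
  obtain \<eta> where y: "s < \<eta>" "\<eta> < t" "f t - f s = f' \<eta> * (t - s)"
    using mean_value[of s t] assms by auto
  have "0 \<le> f' \<xi>"
    using x \<open>\<not> f s < 0\<close> assms f_zero by (simp add: not_less zero_le_mult_iff)
  moreover have "f' \<xi> < f' \<eta>" using deriv_less[of \<xi> \<eta>] x y assms by auto
  ultimately have "0 \<le> f' \<eta> * (t - s)" using assms by simp
  then show False using y \<open>\<not> f s < 0\<close> assms by simp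
qed

lemma f_neg_nearby: "\<forall>\<^sub>F t in at_right 0. f t < 0"
proof -
  obtain u where u: "0 < u" "u < R" "f' u < 0" using deriv_neg_set by blast
  have "f t < 0" if "0 < t" "t < u" for t
  proof -
    have "t * f' t < 0"
      using deriv_less[of t u] u that by (auto intro: mult_pos_neg)
    then show ?thesis using excess_pos[of t] u that by simp
  qed
  then show ?thesis using u by (auto simp: eventually_at_right_field)
qed

subsection \<open>The scalar Newton sequence\<close>

context
  fixes t0 :: real
  assumes t0: "0 < t0" "t0 < rho"
begin

lemma newton_bounds:
  "0 < scalar_newton_seq f f' t0 k \<and> scalar_newton_seq f f' t0 k \<le> t0"
  and newton_step: "scalar_newton_seq f f' t0 (Suc k) = gap (scalar_newton_seq f f' t0 k)"
proof -
  let ?t = "scalar_newton_seq f f' t0"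
  have step: "?t (Suc k) = gap (?t k)" if "0 < ?t k \<and> ?t k \<le> t0" for k
    using gap_pos[of "?t k"] that t0 rho_le by (simp add: gap_def)
  have bounds: "0 < ?t k \<and> ?t k \<le> t0" for k
  proof (induction k)
    case (Suc k)
    then show ?case
      using step[of k] gap_pos[of "?t k"] gap_less_self[of "?t k"] t0 rho_le by linarith
  qed (use t0 in simp)
  show "0 < ?t k \<and> ?t k \<le> t0" by (rule bounds)
  show "?t (Suc k) = gap (?t k)" using bounds by (rule step)
qed

lemma newton_less_rho: "scalar_newton_seq f f' t0 k < rho"
  using newton_bounds[of k] t0 by simp

lemma newton_decreasing: "scalar_newton_seq f f' t0 (Suc k) < scalar_newton_seq f f' t0 k"
  unfolding newton_step using newton_bounds newton_less_rho by (intro gap_less_self) auto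

lemma newton_well_def: "scalar_newton_well_defined R f f' t0"
  unfolding scalar_newton_well_defined_def
proof
  fix k
  have "0 < scalar_newton_seq f f' t0 k" "scalar_newton_seq f f' t0 k < nu"
    using newton_bounds[of k] newton_less_rho[of k] rho_le by auto
  then show "scalar_newton_seq f f' t0 k \<in> {0..<R} \<and> f' (scalar_newton_seq f f' t0 k) \<noteq> 0"
    using deriv_neg[of "scalar_newton_seq f f' t0 k"] nu_le by auto
qed

text \<open>
  The ratio \<open>gap t / t\<close> need not be monotone, so its value at the starting point is not known to
  be a contraction factor; instead, the limit is shown to be a fixed point of \<open>gap\<close>.
\<close>

lemma newton_tendsto: "scalar_newton_seq f f' t0 \<longlonglongrightarrow> 0"
proof -
  let ?t = "scalar_newton_seq f f' t0"
  have "decseq ?t" using newton_decreasing by (intro decseq_SucI less_imp_le)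
  then obtain L where L: "?t \<longlonglongrightarrow> L" and below: "\<And>k. L \<le> ?t k"
    using decseq_convergent[of ?t 0] newton_bounds by (metis less_imp_le)
  have "0 \<le> L" using L newton_bounds by (intro LIMSEQ_le_const) (auto intro: less_imp_le)
  have "L < rho" using below[of 0] t0 by simp
  have "L = 0"
  proof (rule ccontr)
    assume "L \<noteq> 0"
    with \<open>0 \<le> L\<close> have "0 < L" by simp
    have "L < nu" using \<open>L < rho\<close> rho_le by simp
    then have "isCont f' L"
      using deriv_cont \<open>0 < L\<close> nu_le
      by (intro continuous_on_interior[of "{0..<R}"]) (auto simp: interior_atLeastLessThan)
    moreover have "isCont f L"
      using deriv_interior[of L] \<open>0 < L\<close> \<open>L < nu\<close> nu_le by (auto intro: DERIV_isCont)
    ultimately have "isCont gap L"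
      unfolding gap_def[abs_def] using deriv_neg[of L] \<open>0 < L\<close> \<open>L < nu\<close>
      by (intro continuous_intros) auto
    then have "(\<lambda>k. gap (?t k)) \<longlonglongrightarrow> gap L" using L by (rule isCont_tendsto_compose)
    moreover have "(\<lambda>k. gap (?t k)) \<longlonglongrightarrow> L"
      using LIMSEQ_Suc[OF L] by (simp only: newton_step)
    ultimately have "gap L = L" by (rule LIMSEQ_unique)
    then show False using gap_less_self[of L] \<open>0 < L\<close> \<open>L < rho\<close> by simp
  qed
  then show ?thesis using L by simp
qed

lemma newton_superlinear:
  "(\<lambda>k. scalar_newton_seq f f' t0 (Suc k) / scalar_newton_seq f f' t0 k) \<longlonglongrightarrow> 0"
proof -
  have "scalar_newton_seq f f' t0 k \<in> {0<..} \<and> scalar_newton_seq f f' t0 k \<noteq> 0" for k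
    using newton_bounds[of k] by auto
  then have "filterlim (scalar_newton_seq f f' t0) (at_right 0) sequentially"
    using newton_tendsto by (simp add: filterlim_at)
  then show ?thesis unfolding newton_step by (rule filterlim_compose[OF gap_ratio_tendsto])
qed

end

end

section \<open>The operator equation\<close>

text \<open>
  The mean value inequality for \<open>\<tau> \<mapsto> A (\<tau> L v - F (a + \<tau> v))\<close>, whose derivative is
  \<open>A (L - DF (a + \<tau> v)) v\<close>. The map \<open>L\<close> is left free because it is taken to be \<open>DF (a + v)\<close> in
  one application and \<open>DF a\<close> in the other.
\<close>

lemma linearization_error_bound:
  fixes F :: "'a::real_normed_vector \<Rightarrow> 'b::real_normed_vector" and A :: "'b \<Rightarrow>\<^sub>L 'c::real_normed_vector"
  assumes F: "\<And>\<tau>. \<tau> \<in> {0..1} \<Longrightarrow>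
      (F has_derivative blinfun_apply (DF (a + \<tau> *\<^sub>R v))) (at (a + \<tau> *\<^sub>R v))"
    and G_cont: "continuous_on {0..1} G"
    and G: "\<And>\<tau>. 0 < \<tau> \<Longrightarrow> \<tau> < 1 \<Longrightarrow> (G has_real_derivative G' \<tau>) (at \<tau>)"
    and bound: "\<And>\<tau>. 0 < \<tau> \<Longrightarrow> \<tau> < 1 \<Longrightarrow>
      norm (A o\<^sub>L (L - DF (a + \<tau> *\<^sub>R v))) * norm v \<le> G' \<tau>"
  shows "norm (A (L v - (F (a + v) - F a))) \<le> G 1 - G 0"
proof -
  define \<phi> where "\<phi> = (\<lambda>\<tau>. A (\<tau> *\<^sub>R L v - F (a + \<tau> *\<^sub>R v)))"
  have deriv: "(\<phi> has_derivative (\<lambda>h. h *\<^sub>R A (L v - DF (a + \<tau> *\<^sub>R v) v))) (at \<tau>)"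
    if "\<tau> \<in> {0..1}" for \<tau>
  proof -
    have "((\<lambda>\<tau>. a + \<tau> *\<^sub>R v) has_derivative (\<lambda>h. h *\<^sub>R v)) (at \<tau>)"
      by (auto intro!: derivative_eq_intros)
    then have "((\<lambda>\<tau>. F (a + \<tau> *\<^sub>R v)) has_derivative (\<lambda>h. DF (a + \<tau> *\<^sub>R v) (h *\<^sub>R v))) (at \<tau>)"
      using F[OF that] by (rule has_derivative_compose)
    then have "((\<lambda>\<tau>. \<tau> *\<^sub>R L v - F (a + \<tau> *\<^sub>R v)) has_derivative
        (\<lambda>h. h *\<^sub>R L v - DF (a + \<tau> *\<^sub>R v) (h *\<^sub>R v))) (at \<tau>)"
      by (auto intro!: derivative_eq_intros)
    then have "(\<phi> has_derivative (\<lambda>h. A (h *\<^sub>R L v - DF (a + \<tau> *\<^sub>R v) (h *\<^sub>R v)))) (at \<tau>)"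
      unfolding \<phi>_def by (rule bounded_linear.has_derivative[OF blinfun.bounded_linear_right])
    then show ?thesis by (simp add: blinfun.bilinear_simps scaleR_diff_right)
  qed
  have "norm (\<phi> 1 - \<phi> 0) \<le> G 1 - G 0"
  proof (rule differentiable_bound_general[of 0 1 \<phi> G "\<lambda>\<tau>. A (L v - DF (a + \<tau> *\<^sub>R v) v)" G'])
    show "continuous_on {0..1} \<phi>"
      using has_derivative_continuous[OF deriv] by (auto intro!: continuous_at_imp_continuous_on)
    fix \<tau> :: real assume \<tau>: "0 < \<tau>" "\<tau> < 1"
    show "(\<phi> has_vector_derivative A (L v - DF (a + \<tau> *\<^sub>R v) v)) (at \<tau>)"
      using deriv[of \<tau>] \<tau> by (simp add: has_vector_derivative_def)
    show "(G has_vector_derivative G' \<tau>) (at \<tau>)"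
      using G[OF \<tau>] by (simp add: has_real_derivative_iff_has_vector_derivative)
    have "A (L v - DF (a + \<tau> *\<^sub>R v) v) = (A o\<^sub>L (L - DF (a + \<tau> *\<^sub>R v))) v"
      by (simp add: blinfun.bilinear_simps)
    then show "norm (A (L v - DF (a + \<tau> *\<^sub>R v) v)) \<le> G' \<tau>"
      using norm_blinfun[of "A o\<^sub>L (L - DF (a + \<tau> *\<^sub>R v))" v] bound[OF \<tau>] by simp
  qed (use G_cont in auto)
  then show ?thesis by (simp add: \<phi>_def blinfun.bilinear_simps algebra_simps)
qed

locale newton_majorant =
  fixes \<Omega> :: "'a::banach set" and F :: "'a \<Rightarrow> 'b::banach" and DF :: "'a \<Rightarrow> 'a \<Rightarrow>\<^sub>L 'b"
    and xs :: 'a and R :: real and f f' :: "real \<Rightarrow> real"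
  assumes setting: "majorant_setting \<Omega> F DF xs R f f'"
begin

sublocale scalar_majorant R f f'
  using setting by unfold_locales (auto simp: majorant_setting_def)

abbreviation J :: "'b \<Rightarrow>\<^sub>L 'a" where "J \<equiv> blinfun_inverse (DF xs)"

abbreviation \<kappa> :: real where "\<kappa> \<equiv> domain_radius R \<Omega> xs"

lemma domain_bdd: "bdd_above {t \<in> {0..<R}. ball xs t \<subseteq> \<Omega>}"
  by (rule bdd_aboveI[of _ R]) auto

lemma domain_radius_pos: "0 < \<kappa>"
proof -
  obtain e where e: "0 < e" "ball xs e \<subseteq> \<Omega>"
    using setting by (auto simp: majorant_setting_def open_contains_ball)
  have "min e (R / 2) \<in> {t \<in> {0..<R}. ball xs t \<subseteq> \<Omega>}" using e R_pos by auto
  then have "min e (R / 2) \<le> \<kappa>" unfolding domain_radius_def using domain_bdd by (rule cSup_upper)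
  then show ?thesis using e R_pos by linarith
qed

lemma domain_radius_le: "\<kappa> \<le> R"
  unfolding domain_radius_def by (rule cSup_least) (use R_pos in \<open>auto intro!: exI[of _ 0]\<close>)

lemma in_domain:
  assumes "norm (x - xs) < \<kappa>"
  shows "x \<in> \<Omega>"
proof -
  have "{t \<in> {0..<R}. ball xs t \<subseteq> \<Omega>} \<noteq> {}" using R_pos by (auto intro!: exI[of _ 0])
  then obtain t where "ball xs t \<subseteq> \<Omega>" "norm (x - xs) < t"
    using assms less_cSup_iff[OF _ domain_bdd] unfolding domain_radius_def by blast
  then show ?thesis by (auto simp: dist_norm norm_minus_commute)
qed

lemma F_derivative: "norm (x - xs) < \<kappa> \<Longrightarrow> (F has_derivative blinfun_apply (DF x)) (at x)"
  using setting in_domain[of x] by (auto simp: majorant_setting_def)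

lemma F_zero: "F xs = 0" and DF_invertible: "blinfun_invertible (DF xs)"
  using setting by (auto simp: majorant_setting_def)

lemma majorant:
  assumes "0 \<le> \<tau>" "\<tau> \<le> 1" "norm (x - xs) < \<kappa>"
  shows "norm (J o\<^sub>L (DF x - DF (xs + \<tau> *\<^sub>R (x - xs)))) \<le> f' (norm (x - xs)) - f' (\<tau> * norm (x - xs))"
  using setting assms by (auto simp: majorant_setting_def dist_norm norm_minus_commute)

lemma majorant_center:
  assumes "norm (x - xs) < \<kappa>"
  shows "norm (J o\<^sub>L (DF x - DF xs)) \<le> f' (norm (x - xs)) + 1"
  using majorant[of 0 x] assms deriv_zero by simp

lemma segment:
  assumes "norm (x - xs) < \<kappa>" "0 \<le> \<tau>" "\<tau> \<le> 1"
  shows "norm ((xs + \<tau> *\<^sub>R (x - xs)) - xs) < \<kappa>"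
  using assms mult_left_le_one_le[of "norm (x - xs)" \<tau>] by auto

lemma f_along_segment:
  assumes "0 < t" "t < R"
  shows "continuous_on {0..1} (\<lambda>\<tau>. f (\<tau> * t))"
    and "0 < \<tau> \<Longrightarrow> \<tau> < 1 \<Longrightarrow> ((\<lambda>\<tau>. f (\<tau> * t)) has_real_derivative f' (\<tau> * t) * t) (at \<tau>)"
proof -
  have le: "\<tau> * t \<le> t" if "0 \<le> \<tau>" "\<tau> \<le> 1" for \<tau>
    using mult_left_le_one_le[of t \<tau>] assms that by simp
  have "(\<lambda>\<tau>. \<tau> * t) ` {0..1} \<subseteq> {0..<R}" using le assms by (auto intro: le_less_trans[OF le])
  then show "continuous_on {0..1} (\<lambda>\<tau>. f (\<tau> * t))"
    by (intro continuous_on_compose2[OF f_cont] continuous_intros)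
  show "((\<lambda>\<tau>. f (\<tau> * t)) has_real_derivative f' (\<tau> * t) * t) (at \<tau>)" if "0 < \<tau>" "\<tau> < 1"
    by (rule DERIV_chain2[OF deriv_interior]) (use that assms le_less_trans[OF le[of \<tau>]] in \<open>auto intro!: derivative_eq_intros\<close>)
qed

text \<open>
  Here the derivative at the far end \<open>x\<close> of the segment is compared with those along it, as in
  the definition of the Newton step. The comparison function is
  \<open>\<tau> \<mapsto> \<tau> t f'(t) - f(\<tau> t)\<close>.
\<close>

lemma newton_error:
  assumes "norm (x - xs) < \<kappa>"
  shows "norm (J (DF x (x - xs) - F x)) \<le> norm (x - xs) * f' (norm (x - xs)) - f (norm (x - xs))"
proof (cases "x = xs")
  case True
  then show ?thesis using F_zero f_zero by (simp add: blinfun.bilinear_simps)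
next
  case False
  define t where "t = norm (x - xs)"
  have t: "0 < t" "t < R" using False assms domain_radius_le by (auto simp: t_def)
  have "norm (J (DF x (x - xs) - (F (xs + (x - xs)) - F xs))) \<le> (1 * (t * f' t) - f (1 * t)) - (0 * (t * f' t) - f (0 * t))"
  proof (rule linearization_error_bound[where DF = DF and G' = "\<lambda>\<tau>. t * f' t - f' (\<tau> * t) * t"])
    show "(F has_derivative blinfun_apply (DF (xs + \<tau> *\<^sub>R (x - xs)))) (at (xs + \<tau> *\<^sub>R (x - xs)))"
      if "\<tau> \<in> {0..1}" for \<tau>
      using that segment[OF assms] by (intro F_derivative) auto
    show "continuous_on {0..1} (\<lambda>\<tau>. \<tau> * (t * f' t) - f (\<tau> * t))"
      using f_along_segment(1)[OF t] by (intro continuous_intros)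
    fix \<tau> :: real assume \<tau>: "0 < \<tau>" "\<tau> < 1"
    show "((\<lambda>\<tau>. \<tau> * (t * f' t) - f (\<tau> * t)) has_real_derivative t * f' t - f' (\<tau> * t) * t) (at \<tau>)"
      using f_along_segment(2)[OF t \<tau>] by (auto intro!: derivative_eq_intros)
    show "norm (J o\<^sub>L (DF x - DF (xs + \<tau> *\<^sub>R (x - xs)))) * norm (x - xs) \<le> t * f' t - f' (\<tau> * t) * t"
      using mult_right_mono[OF majorant[of \<tau> x] norm_ge_zero[of "x - xs"]] \<tau> assms
      by (simp add: t_def algebra_simps)
  qed
  then show ?thesis using F_zero f_zero by (simp add: t_def)
qed

text \<open>
  Here the derivatives along the segment are compared with the one at the centre \<open>x\<^sub>*\<close>: the
  majorant condition, applied at the point \<open>x\<^sub>* + \<tau> (x - x\<^sub>*)\<close> with parameter \<open>0\<close>, bounds the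
  integrand by \<open>(f'(\<tau> t) + 1) t\<close>.
\<close>

lemma center_error:
  assumes "norm (x - xs) < \<kappa>"
  shows "norm (J (DF xs (x - xs) - F x)) \<le> f (norm (x - xs)) + norm (x - xs)"
proof (cases "x = xs")
  case True
  then show ?thesis using F_zero f_zero by (simp add: blinfun.bilinear_simps)
next
  case False
  define t where "t = norm (x - xs)"
  have t: "0 < t" "t < R" using False assms domain_radius_le by (auto simp: t_def)
  have "norm (J (DF xs (x - xs) - (F (xs + (x - xs)) - F xs))) \<le> (f (1 * t) + 1 * t) - (f (0 * t) + 0 * t)"
  proof (rule linearization_error_bound[where DF = DF and G' = "\<lambda>\<tau>. f' (\<tau> * t) * t + t"])
    show "(F has_derivative blinfun_apply (DF (xs + \<tau> *\<^sub>R (x - xs)))) (at (xs + \<tau> *\<^sub>R (x - xs)))"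
      if "\<tau> \<in> {0..1}" for \<tau>
      using that segment[OF assms] by (intro F_derivative) auto
    show "continuous_on {0..1} (\<lambda>\<tau>. f (\<tau> * t) + \<tau> * t)"
      using f_along_segment(1)[OF t] by (intro continuous_intros)
    fix \<tau> :: real assume \<tau>: "0 < \<tau>" "\<tau> < 1"
    show "((\<lambda>\<tau>. f (\<tau> * t) + \<tau> * t) has_real_derivative f' (\<tau> * t) * t + t) (at \<tau>)"
      using f_along_segment(2)[OF t \<tau>] by (auto intro!: derivative_eq_intros)
    let ?y = "xs + \<tau> *\<^sub>R (x - xs)"
    have "norm (J o\<^sub>L (DF xs - DF ?y)) = norm (J o\<^sub>L (DF ?y - DF xs))"
    proof -
      have "J o\<^sub>L (DF xs - DF ?y) = - (J o\<^sub>L (DF ?y - DF xs))"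
        by (rule blinfun_eqI) (simp add: blinfun.bilinear_simps)
      then show ?thesis by simp
    qed
    also have "\<dots> \<le> f' (\<tau> * t) + 1"
      using majorant_center[of ?y] segment[OF assms, of \<tau>] \<tau> by (simp add: t_def)
    finally show "norm (J o\<^sub>L (DF xs - DF ?y)) * norm (x - xs) \<le> f' (\<tau> * t) * t + t"
      using mult_right_mono[OF _ norm_ge_zero[of "x - xs"]] by (fastforce simp: t_def algebra_simps)
  qed
  then show ?thesis using F_zero f_zero by (simp add: t_def)
qed

lemma derivative_invertible:
  assumes "norm (x - xs) < \<kappa>" "norm (x - xs) < nu"
  shows "blinfun_invertible (DF x)"
    and "- f' (norm (x - xs)) * norm v \<le> norm (J (DF x v))"
proof -
  have *: "norm (J o\<^sub>L (DF x - DF xs)) \<le> f' (norm (x - xs)) + 1" "f' (norm (x - xs)) + 1 < 1"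
    using majorant_center assms deriv_neg[of "norm (x - xs)"] by auto
  show "blinfun_invertible (DF x)" using invertible_near_invertible(1)[OF DF_invertible *] .
  show "- f' (norm (x - xs)) * norm v \<le> norm (J (DF x v))"
    using invertible_near_invertible(2)[OF DF_invertible *, of v] by simp
qed

text \<open>
  If \<open>y\<close> is the Newton iterate of \<open>x\<close>, then \<open>F'(x) (y - x\<^sub>*) = F'(x) (x - x\<^sub>*) - F x\<close>, the
  quantity bounded by \<open>newton_error\<close>.
\<close>

lemma newton_contraction:
  assumes "norm (x - xs) < \<kappa>" "norm (x - xs) < nu"
  shows "norm (x - blinfun_inverse (DF x) (F x) - xs) \<le> gap (norm (x - xs))"
proof -
  let ?y = "x - blinfun_inverse (DF x) (F x)" and ?t = "norm (x - xs)"
  have "DF x (?y - xs) = DF x (x - xs) - F x"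
    using blinfun_inverse(2)[OF derivative_invertible(1)[OF assms]]
    by (simp add: blinfun.bilinear_simps algebra_simps)
  then have "- f' ?t * norm (?y - xs) \<le> ?t * f' ?t - f ?t"
    using derivative_invertible(2)[OF assms, of "?y - xs"] newton_error[OF assms(1)] by simp
  then show ?thesis
    using deriv_neg[of ?t] assms(2) by (subst gap_eq) (simp_all add: pos_le_divide_eq mult.commute del: divide_minus_right)
qed

lemma unique_zero:
  assumes "\<sigma> = Sup {t \<in> {0<..<\<kappa>}. f t < 0}"
  shows "{x \<in> ball xs \<sigma>. F x = 0} = {xs}"
proof -
  let ?S = "{t \<in> {0<..<\<kappa>}. f t < 0}"
  have bdd: "bdd_above ?S" by (rule bdd_aboveI[of _ \<kappa>]) auto
  have "\<forall>\<^sub>F t in at_right 0. t < \<kappa>"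
    using domain_radius_pos eventually_at_right_field by blast
  with f_neg_nearby eventually_less_R have "\<forall>\<^sub>F t in at_right 0. t \<in> ?S"
    by eventually_elim auto
  then obtain u where u: "u \<in> ?S"
    using eventually_happens trivial_limit_at_right_real by blast
  then have "0 < \<sigma>" using cSup_upper[OF u bdd] assms by auto
  moreover have "x = xs" if x: "norm (x - xs) < \<sigma>" "F x = 0" for x
  proof (rule ccontr)
    assume "x \<noteq> xs"
    define t where "t = norm (x - xs)"
    obtain s where s: "s \<in> ?S" "t < s"
      using x(1) u less_cSup_iff[OF _ bdd] unfolding assms t_def by blast
    have "f t < 0"
      using neg_before_neg[of t s] s \<open>x \<noteq> xs\<close> domain_radius_le by (auto simp: t_def)
    moreover have "t \<le> f t + t"
      using center_error[of x] x(2) s by (simp add: t_def blinfun_inverse(1)[OF DF_invertible])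
    ultimately show False by simp
  qed
  ultimately show ?thesis using F_zero by (auto simp: dist_norm norm_minus_commute)
qed

subsection \<open>The Newton sequence\<close>

context
  fixes x0 :: 'a
  assumes x0: "x0 \<noteq> xs" "norm (x0 - xs) < \<kappa>" "norm (x0 - xs) < rho"
begin

lemma start: "0 < norm (x0 - xs)"
  using x0 by simp

lemma newton_majorized:
  "norm (newton_seq F DF x0 k - xs) \<le> scalar_newton_seq f f' (norm (x0 - xs)) k"
proof (induction k)
  case (Suc k)
  let ?t = "scalar_newton_seq f f' (norm (x0 - xs)) k" and ?e = "norm (newton_seq F DF x0 k - xs)"
  have t: "?t < \<kappa>" "?t < nu"
    using newton_bounds[OF start x0(3), of k] x0 rho_le by auto
  then have "norm (newton_seq F DF x0 (Suc k) - xs) \<le> gap ?e"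
    using newton_contraction[of "newton_seq F DF x0 k"] Suc by simp
  also have "\<dots> \<le> gap ?t" using Suc t by (intro gap_le) auto
  finally show ?case unfolding newton_step[OF start x0(3)] .
qed simp

lemma newton_within:
  "norm (newton_seq F DF x0 k - xs) < \<kappa>" "norm (newton_seq F DF x0 k - xs) < rho"
  using newton_majorized[of k] newton_bounds[OF start x0(3), of k] x0 by auto

lemma newton_seq_step:
  "norm (newton_seq F DF x0 (Suc k) - xs) \<le> gap (norm (newton_seq F DF x0 k - xs))"
  using newton_contraction[of "newton_seq F DF x0 k"] newton_within[of k] rho_le by simp

lemma newton_seq_well_defined: "newton_well_defined \<Omega> F DF x0"
  unfolding newton_well_defined_def
proof (intro allI conjI)
  fix k
  show "newton_seq F DF x0 k \<in> \<Omega>" using newton_within(1) by (rule in_domain)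
  show "blinfun_invertible (DF (newton_seq F DF x0 k))"
    using newton_within[of k] rho_le by (intro derivative_invertible(1)) auto
qed

lemma newton_seq_tendsto: "newton_seq F DF x0 \<longlonglongrightarrow> xs"
proof -
  have "(\<lambda>k. newton_seq F DF x0 k - xs) \<longlonglongrightarrow> 0"
    using newton_majorized by (intro Lim_null_comparison[OF _ newton_tendsto[OF start x0(3)]]) auto
  then show ?thesis by (simp add: LIM_zero_iff)
qed

lemma newton_seq_superlinear:
  "(\<lambda>k. norm (newton_seq F DF x0 (Suc k) - xs) / norm (newton_seq F DF x0 k - xs)) \<longlonglongrightarrow> 0"
proof -
  let ?e = "\<lambda>k. norm (newton_seq F DF x0 k - xs)"
  \<comment> \<open>An iterate may hit the zero exactly. The quotient is then \<open>0\<close> by the convention on division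
      by \<open>0\<close>, which makes \<open>gap t / t\<close> continuous at \<open>0\<close> from the right.\<close>
  have "at (0::real) within {0..} = at_right 0"
    by (rule at_within_nhd[of 0 UNIV]) auto
  then have "continuous (at 0 within {0..}) (\<lambda>t. gap t / t)"
    using gap_ratio_tendsto by (simp add: continuous_within)
  moreover have "?e \<longlonglongrightarrow> 0"
    using newton_seq_tendsto by (simp add: tendsto_norm_zero_iff LIM_zero)
  ultimately have "(\<lambda>k. gap (?e k) / ?e k) \<longlonglongrightarrow> gap 0 / 0"
    by (intro continuous_within_tendsto_compose'[of 0 "{0..}" "\<lambda>t. gap t / t"]) auto
  then have lim: "(\<lambda>k. gap (?e k) / ?e k) \<longlonglongrightarrow> 0" by simp
  show ?thesis
  proof (rule tendsto_sandwich[OF _ _ tendsto_const lim])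
    show "\<forall>\<^sub>F k in sequentially. ?e (Suc k) / ?e k \<le> gap (?e k) / ?e k"
      using newton_seq_step by (intro always_eventually allI divide_right_mono) auto
  qed simp
qed

lemma newton_seq_order:
  fixes p :: real
  assumes mono: "strict_mono_on {0<..<nu} (\<lambda>t. (f t / f' t - t) / t powr (p + 1))"
  defines "t \<equiv> scalar_newton_seq f f' (norm (x0 - xs))"
  shows "t (Suc (Suc k)) / t (Suc k) powr (p + 1) < t (Suc k) / t k powr (p + 1)"
    and "norm (newton_seq F DF x0 (Suc k) - xs)
      \<le> t (Suc k) / t k powr (p + 1) * norm (newton_seq F DF x0 k - xs) powr (p + 1)"
proof -
  have t_in: "t k \<in> {0<..<nu}" for k
    using newton_bounds[OF start x0(3), of k] x0 rho_le by (auto simp: t_def)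
  have step: "t (Suc k) = gap (t k)" for k
    using newton_step[OF start x0(3)] by (simp only: t_def)
  have less: "gap s / s powr (p + 1) < gap u / u powr (p + 1)"
    if "s \<in> {0<..<nu}" "u \<in> {0<..<nu}" "s < u" for s u
    using strict_mono_onD[OF mono that] by (simp add: gap_def)
  show "t (Suc (Suc k)) / t (Suc k) powr (p + 1) < t (Suc k) / t k powr (p + 1)"
  proof -
    have "t (Suc k) < t k" unfolding t_def by (rule newton_decreasing[OF start x0(3)])
    then show ?thesis
      using less[OF t_in[of "Suc k"] t_in[of k]] step[of "Suc k"] step[of k] by metis
  qed
  let ?e = "norm (newton_seq F DF x0 k - xs)"
  show "norm (newton_seq F DF x0 (Suc k) - xs) \<le> t (Suc k) / t k powr (p + 1) * ?e powr (p + 1)"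
  proof (cases "?e = 0")
    case True
    then show ?thesis using newton_seq_step[of k] gap_zero by simp
  next
    case False
    have e: "?e \<in> {0<..<nu}" using False newton_within(2)[of k] rho_le by auto
    have "?e \<le> t k" using newton_majorized by (simp add: t_def)
    then have "gap ?e / ?e powr (p + 1) \<le> gap (t k) / t k powr (p + 1)"
      using less[OF e t_in[of k]] by (cases "?e = t k") auto
    then have "gap ?e \<le> gap (t k) / t k powr (p + 1) * ?e powr (p + 1)"
      using False by (simp add: pos_divide_le_eq)
    then show ?thesis using newton_seq_step[of k] unfolding step by linarith
  qed
qed

end

end

section \<open>Sharpness of the radius\<close>

context scalar_majorant
begin

text \<open>
  Since \<open>f(0) = 0\<close>, the odd extension is differentiable at \<open>0\<close> too, and its derivative is the even
  extension of \<open>f'\<close>. On a ball around \<open>0\<close> it satisfies the majorant condition with equality.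
\<close>

definition odd_ext :: "real \<Rightarrow> real" where
  "odd_ext x = (if x < 0 then - f (- x) else f x)"

lemma odd_ext_derivative:
  assumes "\<bar>x\<bar> < R"
  shows "(odd_ext has_real_derivative f' \<bar>x\<bar>) (at x)"
proof -
  consider "0 < x" | "x < 0" | "x = 0" by linarith
  then show ?thesis
  proof cases
    case 1
    then have "(f has_real_derivative f' \<bar>x\<bar>) (at x)" using deriv_interior assms by simp
    then show ?thesis
      by (rule has_field_derivative_transform_within_open[where S = "{0<..}"])
        (use 1 in \<open>auto simp: odd_ext_def\<close>)
  next
    case 2
    have "((\<lambda>x. - f (- x)) has_real_derivative f' \<bar>x\<bar>) (at x)"
      using 2 assms by (auto intro!: derivative_eq_intros DERIV_chain2[OF deriv_interior])
    then show ?thesis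
      by (rule has_field_derivative_transform_within_open[where S = "{..<0}"])
        (use 2 in \<open>auto simp: odd_ext_def\<close>)
  next
    case 3
    have "((\<lambda>h. odd_ext h / h) \<longlongrightarrow> - 1) (at_right 0)"
      using secant_tendsto by (rule Lim_transform_eventually)
        (auto simp: odd_ext_def eventually_at_right_field intro: exI[of _ 1])
    moreover have "((\<lambda>h. odd_ext h / h) \<longlongrightarrow> - 1) (at_left 0)"
    proof -
      have "((\<lambda>h. f (- h) / (- h)) \<longlongrightarrow> - 1) (at_left 0)"
        using secant_tendsto by (simp add: filterlim_at_left_to_right)
      then show ?thesis by (rule Lim_transform_eventually)
        (auto simp: odd_ext_def eventually_at_left_field intro: exI[of _ "-1"])
    qed
    ultimately have "((\<lambda>h. odd_ext h / h) \<longlongrightarrow> - 1) (at 0)"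
      by (simp add: filterlim_split_at)
    then show ?thesis
      using 3 f_zero deriv_zero by (simp add: has_field_derivative_iff odd_ext_def)
  qed
qed

abbreviation scaling :: "real \<Rightarrow> real \<Rightarrow>\<^sub>L real" where
  "scaling c \<equiv> c *\<^sub>R id_blinfun"

lemma scaling_inverse:
  assumes "c \<noteq> 0"
  shows "blinfun_inverse (scaling c) = scaling (1 / c)" and "blinfun_invertible (scaling c)"
proof -
  have *: "scaling (1 / c) o\<^sub>L scaling c = id_blinfun" "scaling c o\<^sub>L scaling (1 / c) = id_blinfun"
    using assms by (auto intro!: blinfun_eqI simp: blinfun.bilinear_simps)
  then show "blinfun_inverse (scaling c) = scaling (1 / c)" by (rule blinfun_inverse_eqI)
  show "blinfun_invertible (scaling c)" unfolding blinfun_invertible_def using * by blast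
qed

lemma domain_radius_ball:
  assumes "0 < \<kappa>" "\<kappa> \<le> R"
  shows "domain_radius R (ball (0::real) \<kappa>) 0 = \<kappa>"
  unfolding domain_radius_def
proof (rule cSup_eq_non_empty)
  show "{t \<in> {0..<R}. ball (0::real) t \<subseteq> ball 0 \<kappa>} \<noteq> {}"
    using assms by (auto intro!: exI[of _ 0])
  fix t assume "t \<in> {t \<in> {0..<R}. ball (0::real) t \<subseteq> ball 0 \<kappa>}"
  then show "t \<le> \<kappa>" using assms by (auto simp: ball_subset_ball_iff)
next
  fix y assume y: "\<And>t. t \<in> {t \<in> {0..<R}. ball (0::real) t \<subseteq> ball 0 \<kappa>} \<Longrightarrow> t \<le> y"
  show "\<kappa> \<le> y"
  proof (rule dense_le_bounded[OF assms(1)])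
    fix w assume "0 < w" "w < \<kappa>"
    then show "w \<le> y" using assms by (intro y) (auto intro: subset_ball)
  qed
qed

lemma odd_ext_setting:
  assumes "0 < \<kappa>" "\<kappa> \<le> R"
  shows "majorant_setting (ball 0 \<kappa>) odd_ext (\<lambda>x. scaling (f' \<bar>x\<bar>)) 0 R f f'"
  unfolding majorant_setting_def
proof (intro conjI ballI)
  show "(odd_ext has_derivative blinfun_apply (scaling (f' \<bar>x\<bar>))) (at x)" if "x \<in> ball 0 \<kappa>" for x
  proof -
    have "blinfun_apply (scaling (f' \<bar>x\<bar>)) = (*) (f' \<bar>x\<bar>)"
      by (simp add: fun_eq_iff blinfun.bilinear_simps)
    then show ?thesis
      using odd_ext_derivative[of x] that assms by (simp add: has_field_derivative_def)
  qed
  have "continuous_on (ball 0 \<kappa>) (\<lambda>x. f' \<bar>x\<bar>)"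
    using assms by (intro continuous_on_compose2[OF deriv_cont] continuous_intros) auto
  then show "continuous_on (ball 0 \<kappa>) (\<lambda>x. scaling (f' \<bar>x\<bar>))"
    by (intro continuous_intros)
  show "blinfun_invertible (scaling (f' \<bar>0\<bar>))" using deriv_zero by (intro scaling_inverse) simp
  fix \<tau> x :: real
  assume \<tau>: "\<tau> \<in> {0..1}" and "x \<in> ball 0 (domain_radius R (ball (0::real) \<kappa>) 0)"
  then have x: "\<bar>x\<bar> < R" using domain_radius_ball[OF assms] assms by simp
  have "\<tau> * \<bar>x\<bar> \<le> \<bar>x\<bar>" using \<tau> mult_left_le_one_le[of "\<bar>x\<bar>" \<tau>] by simp
  then have "f' (\<tau> * \<bar>x\<bar>) \<le> f' \<bar>x\<bar>" using x \<tau> by (intro deriv_le) auto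
  moreover have "blinfun_inverse (scaling (f' \<bar>0\<bar>)) o\<^sub>L
      (scaling (f' \<bar>x\<bar>) - scaling (f' \<bar>0 + \<tau> *\<^sub>R (x - 0)\<bar>)) = scaling (f' (\<tau> * \<bar>x\<bar>) - f' \<bar>x\<bar>)"
    using \<tau> scaling_inverse(1)[of "f' \<bar>0\<bar>"] deriv_zero
    by (intro blinfun_eqI) (auto simp: blinfun.bilinear_simps abs_mult algebra_simps)
  ultimately show "norm (blinfun_inverse (scaling (f' \<bar>0\<bar>)) o\<^sub>L
      (scaling (f' \<bar>x\<bar>) - scaling (f' \<bar>0 + \<tau> *\<^sub>R (x - 0)\<bar>))) \<le> f' (norm (x - 0)) - f' (\<tau> * norm (x - 0))"
    by simp
qed (use assms R_pos f_zero deriv_zero deriv deriv_cont deriv_mono in \<open>auto simp: odd_ext_def\<close>)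

text \<open>
  The hypothesis says \<open>f(s)/f'(s) = 2 s\<close>, so the Newton step from \<open>s\<close> leads to \<open>- s\<close> and, by
  oddness, back.
\<close>

lemma odd_ext_newton_cycle:
  assumes "0 < s" and "f s / (s * f' s) - 1 = 1"
  shows "\<bar>newton_seq odd_ext (\<lambda>x. scaling (f' \<bar>x\<bar>)) s k\<bar> = s"
proof (induction k)
  case (Suc k)
  have ne: "f' s \<noteq> 0" using assms by auto
  then have f: "f s = 2 * s * f' s" using assms by (simp add: field_simps)
  let ?x = "newton_seq odd_ext (\<lambda>x. scaling (f' \<bar>x\<bar>)) s k"
  have "?x = s \<or> ?x = - s" using Suc by linarith
  then show ?case
    using f ne assms(1) Suc
    by (auto simp: scaling_inverse blinfun.bilinear_simps odd_ext_def)
qed (use assms in simp)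

lemma rho_best:
  assumes "0 < \<kappa>" "\<kappa> \<le> R" "rho < \<kappa>" "f rho / (rho * f' rho) - 1 = 1"
  shows "best_convergence_radius R f f' \<kappa> rho"
  unfolding best_convergence_radius_def
proof (intro allI impI)
  fix r' assume "rho < r'"
  let ?D = "\<lambda>x. scaling (f' \<bar>x\<bar>)"
  have "\<not> newton_seq odd_ext ?D rho \<longlonglongrightarrow> 0"
  proof
    assume "newton_seq odd_ext ?D rho \<longlonglongrightarrow> 0"
    then have "(\<lambda>k. \<bar>newton_seq odd_ext ?D rho k\<bar>) \<longlonglongrightarrow> 0" by (rule tendsto_rabs_zero)
    then have "(\<lambda>k::nat. rho) \<longlonglongrightarrow> 0"
      by (simp only: odd_ext_newton_cycle[OF rho_pos assms(4)])
    then show False using rho_pos by (simp add: LIMSEQ_const_iff)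
  qed
  then show "\<exists>(\<Omega> :: real set) (F :: real \<Rightarrow> real) DF xs x0.
      majorant_setting \<Omega> F DF xs R f f' \<and> domain_radius R \<Omega> xs = \<kappa> \<and>
      x0 \<in> \<Omega> \<and> 0 < norm (x0 - xs) \<and> norm (x0 - xs) < r' \<and>
      \<not> (newton_well_defined \<Omega> F DF x0 \<and> newton_seq F DF x0 \<longlonglongrightarrow> xs)"
    using odd_ext_setting[OF assms(1,2)] domain_radius_ball[OF assms(1,2)] assms(3) rho_pos \<open>rho < r'\<close>
    by (intro exI[of _ "ball 0 \<kappa>"] exI[of _ odd_ext] exI[of _ ?D] exI[of _ "0::real"]
        exI[of _ rho] conjI) auto
qed

end

section \<open>Local convergence of Newton's method\<close>

theorem theorem2:
  fixes \<Omega> :: "'a::banach set" and F :: "'a \<Rightarrow> 'b::banach" and DF :: "'a \<Rightarrow> 'a \<Rightarrow>\<^sub>L 'b"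
    and xs :: 'a and R \<kappa> \<nu> \<rho> r \<sigma> :: real and f f' :: "real \<Rightarrow> real"
  assumes "majorant_setting \<Omega> F DF xs R f f'"
    and "\<kappa> = domain_radius R \<Omega> xs"
    and "\<nu> = Sup {t \<in> {0..<R}. f' t < 0}"
    and "\<rho> = Sup {\<delta> \<in> {0<..<\<nu>}. \<forall>t\<in>{0<..<\<delta>}. (f t / f' t - t) / t < 1}"
    and "r = min \<kappa> \<rho>"
    and "\<sigma> = Sup {t \<in> {0<..<\<kappa>}. f t < 0}"
  shows
    "(\<forall>x0 \<in> ball xs r - {xs}.
        let x = newton_seq F DF x0; t = scalar_newton_seq f f' (norm (x0 - xs)) in
          newton_well_defined \<Omega> F DF x0 \<and>
          scalar_newton_well_defined R f f' (norm (x0 - xs)) \<and>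
          (\<forall>k. t (Suc k) < t k) \<and> (\<forall>k. t k \<in> {0<..<r}) \<and> t \<longlonglongrightarrow> 0 \<and>
          (\<forall>k. x k \<in> ball xs r) \<and> x \<longlonglongrightarrow> xs \<and>
          (\<lambda>k. norm (x (Suc k) - xs) / norm (x k - xs)) \<longlonglongrightarrow> 0 \<and>
          (\<lambda>k. t (Suc k) / t k) \<longlonglongrightarrow> 0) \<and>
     {x \<in> ball xs \<sigma>. F x = 0} = {xs} \<and>
     (f \<rho> / (\<rho> * f' \<rho>) - 1 = 1 \<and> \<rho> < \<kappa> \<longrightarrow>
        r = \<rho> \<and> best_convergence_radius R f f' \<kappa> \<rho>) \<and>
     (\<forall>p::real. 0 \<le> p \<and> p \<le> 1 \<and>
        strict_mono_on {0<..<\<nu>} (\<lambda>t. (f t / f' t - t) / t powr (p + 1)) \<longrightarrow>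
        (\<forall>x0 \<in> ball xs r - {xs}.
           let x = newton_seq F DF x0; t = scalar_newton_seq f f' (norm (x0 - xs)) in
             (\<forall>k. t (Suc (Suc k)) / t (Suc k) powr (p + 1) < t (Suc k) / t k powr (p + 1)) \<and>
             (\<forall>k. norm (x (Suc k) - xs)
                    \<le> t (Suc k) / t k powr (p + 1) * norm (x k - xs) powr (p + 1))))"
proof -
  interpret newton_majorant \<Omega> F DF xs R f f' using assms(1) by unfold_locales
  have nu: "\<nu> = nu" using assms(3) by (simp add: nu_def)
  have rho: "\<rho> = rho" using assms(4) by (simp add: rho_def nu)
  have start: "x0 \<noteq> xs" "norm (x0 - xs) < domain_radius R \<Omega> xs" "norm (x0 - xs) < rho"
    if "x0 \<in> ball xs r - {xs}" for x0
    using that assms(2,5) rho by (auto simp: dist_norm norm_minus_commute)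
  show ?thesis
  proof (intro conjI ballI impI allI)
    fix x0 assume x0: "x0 \<in> ball xs r - {xs}"
    note s = start[OF x0]
    have pos: "0 < norm (x0 - xs)" using s by simp
    have lt: "norm (x0 - xs) < r" using s assms(2,5) rho by simp
    have t_in: "scalar_newton_seq f f' (norm (x0 - xs)) k \<in> {0<..<r}" for k
      using newton_bounds[OF pos s(3), of k] lt by auto
    moreover have "newton_seq F DF x0 k \<in> ball xs r" for k
      using newton_majorized[OF s, of k] t_in[of k] by (simp add: dist_norm norm_minus_commute)
    ultimately show "let x = newton_seq F DF x0; t = scalar_newton_seq f f' (norm (x0 - xs)) in
          newton_well_defined \<Omega> F DF x0 \<and>
          scalar_newton_well_defined R f f' (norm (x0 - xs)) \<and>
          (\<forall>k. t (Suc k) < t k) \<and> (\<forall>k. t k \<in> {0<..<r}) \<and> t \<longlonglongrightarrow> 0 \<and>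
          (\<forall>k. x k \<in> ball xs r) \<and> x \<longlonglongrightarrow> xs \<and>
          (\<lambda>k. norm (x (Suc k) - xs) / norm (x k - xs)) \<longlonglongrightarrow> 0 \<and>
          (\<lambda>k. t (Suc k) / t k) \<longlonglongrightarrow> 0"
      unfolding Let_def
      using newton_seq_well_defined[OF s] newton_well_def[OF pos s(3)]
        newton_decreasing[OF pos s(3)] newton_tendsto[OF pos s(3)] newton_seq_tendsto[OF s]
        newton_seq_superlinear[OF s] newton_superlinear[OF pos s(3)] by blast
  next
    show "{x \<in> ball xs \<sigma>. F x = 0} = {xs}" using unique_zero assms(2,6) by simp
  next
    assume *: "f \<rho> / (\<rho> * f' \<rho>) - 1 = 1 \<and> \<rho> < \<kappa>"
    then show "r = \<rho>" using assms(5) by simp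
    show "best_convergence_radius R f f' \<kappa> \<rho>"
      using rho_best * domain_radius_pos domain_radius_le assms(2) rho by simp
  next
    fix p :: real and x0
    assume p: "0 \<le> p \<and> p \<le> 1 \<and>
      strict_mono_on {0<..<\<nu>} (\<lambda>t. (f t / f' t - t) / t powr (p + 1))"
      and x0: "x0 \<in> ball xs r - {xs}"
    have "strict_mono_on {0<..<nu} (\<lambda>t. (f t / f' t - t) / t powr (p + 1))" using p nu by simp
    note order = newton_seq_order[OF start[OF x0] this]
    show "let x = newton_seq F DF x0; t = scalar_newton_seq f f' (norm (x0 - xs)) in
             (\<forall>k. t (Suc (Suc k)) / t (Suc k) powr (p + 1) < t (Suc k) / t k powr (p + 1)) \<and>
             (\<forall>k. norm (x (Suc k) - xs)
                    \<le> t (Suc k) / t k powr (p + 1) * norm (x k - xs) powr (p + 1))"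
      unfolding Let_def using order by blast
  qed
qed

end
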